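(* Let $X$ be a compact doubling metric space, let $\{\mathcal{Q}_n\}_{n\in\mathbb{N}}$ be a general filtration of a set $E\subset X$ with associated sequences $(\delta_n)_{n\in\mathbb{N}}$ and $(\gamma_n)_{n\in\mathbb{N}}$, and let $\mu$ be a finite Borel regular measure on $E$. Then $$\dim_{\mathrm{cor}}(\mu)=\liminf_{n\to\infty}\frac{\log\sum_{Q\in\mathcal{Q}_n}\mu(Q)^2}{\log\delta_n}.$$
   Context: Doubling. A metric space $(X,d)$ is doubling if there is $N\in\mathbb{N}$ such that every closed ball $B(x,r)$ with $x\in X$, $r>0$ can be covered by $N$ balls of radius $r/2$. General filtration. Let $(\delta_n)_{n\in\mathbb{N}}$ and $(\gamma_n)_{n\in\mathbb{N}}$ be two decreasing sequences of positive real numbers satisfying (F1) $\delta_n\le\gamma_n$ for all $n\in\mathbb{N}$, (F2) $\lim_{n\to\infty}\gamma_n=0$, (F3) $\lim_{n\to\infty}\log\delta_n/\log\delta_{n+1}=1$, (F4) $\lim_{n\to\infty}\log\gamma_n/\log\delta_n=1$. For each $n\in\mathbb{N}$ let $\mathcal{Q}_n$ be a collection of pairwise disjoint Borel subsets of $X$ such that each $Q\in\mathcal{Q}_n$ contains a (closed) ball $B_Q$ of radius $\delta_n$ and is contained in a (closed) ball $B^Q$ of radius $\gamma_n$. Put $E=\bigcap_{n\in\mathbb{N}}\bigcup_{Q\in\mathcal{Q}_n}Q$. Then $\{\mathcal{Q}_n\}_{n\in\mathbb{N}}$ is called a general filtration of $E$. No nesting between the collections $\mathcal{Q}_n$ for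 different $n$ is assumed. Measure on $E$. "$\mu$ is a measure on $E$" means that $\mu$ is regarded as a measure on $X$ with $\mu(X\setminus E)=0$. Correlation dimension. For $s\ge0$ the $s$-energy of $\mu$ is $I_s(\mu)=\iint d(x,y)^{-s}\,\mathrm{d}\mu(x)\,\mathrm{d}\mu(y)$, and $$\dim_{\mathrm{cor}}(\mu)=\inf\{s: I_s(\mu)=\infty\}=\sup\{s: I_s(\mu)<\infty\}.$$ *)

theory Defs
  imports "HOL-Analysis.Analysis"
begin

text \<open>The ambient metric space \<open>X\<close> is a type of class \<^class>\<open>metric_space\<close>, so \<open>X = UNIV\<close>.
  Balls are closed; a ball of the cover is given by its centre.\<close>

definition doubling_space :: "'a::metric_space itself \<Rightarrow> bool" where
  "doubling_space (_ :: 'a itself) \<longleftrightarrow>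
     (\<exists>N::nat. \<forall>(x::'a) (r::real). r > 0 \<longrightarrow>
        (\<exists>C. finite C \<and> card C \<le> N \<and> cball x r \<subseteq> (\<Union>c\<in>C. cball c (r / 2))))"

definition general_filtration ::
  "'a::metric_space set \<Rightarrow> (nat \<Rightarrow> real) \<Rightarrow> (nat \<Rightarrow> real) \<Rightarrow> (nat \<Rightarrow> 'a set set) \<Rightarrow> bool" where
  "general_filtration E \<delta> \<gamma> \<Q> \<longleftrightarrow>
     (\<forall>n. 0 < \<delta> n) \<and> (\<forall>n. 0 < \<gamma> n) \<and> decseq \<delta> \<and> decseq \<gamma> \<and>
     (\<forall>n. \<delta> n \<le> \<gamma> n) \<and>
     \<gamma> \<longlonglongrightarrow> 0 \<and>
     (\<lambda>n. ln (\<delta> n) / ln (\<delta> (Suc n))) \<longlonglongrightarrow> 1 \<and>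
     (\<lambda>n. ln (\<gamma> n) / ln (\<delta> n)) \<longlonglongrightarrow> 1 \<and>
     (\<forall>n. disjoint (\<Q> n) \<and>
        (\<forall>Q\<in>\<Q> n. Q \<in> sets borel \<and> (\<exists>x. cball x (\<delta> n) \<subseteq> Q) \<and> (\<exists>x. Q \<subseteq> cball x (\<gamma> n)))) \<and>
     E = (\<Inter>n. \<Union>(\<Q> n))"

text \<open>In a compact space the collections are finite, so \<^const>\<open>sum\<close> over \<open>\<Q> n\<close> is the
  intended sum, and \<open>E\<close> is Borel.\<close>

lemma general_filtration_finite:
  fixes E :: "'a::metric_space set"
  assumes X: "compact (UNIV :: 'a set)" and F: "general_filtration E \<delta> \<gamma> \<Q>"
  shows "finite (\<Q> n)"
proof -
  have d: "\<delta> n > 0" and dj: "disjoint (\<Q> n)"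
    and b: "\<forall>Q\<in>\<Q> n. \<exists>x. cball x (\<delta> n) \<subseteq> Q"
    using F by (auto simp: general_filtration_def)
  obtain c where c: "\<And>Q. Q \<in> \<Q> n \<Longrightarrow> cball (c Q) (\<delta> n) \<subseteq> Q"
    using b by metis
  obtain K :: "'a set" where K: "finite K" "UNIV \<subseteq> (\<Union>k\<in>K. ball k (\<delta> n / 2))"
    using seq_compact_imp_totally_bounded[OF X[unfolded compact_eq_seq_compact_metric],
        rule_format, of "\<delta> n / 2"] d by auto
  define k where "k Q = (SOME k. k \<in> K \<and> c Q \<in> ball k (\<delta> n / 2))" for Q
  have k: "k Q \<in> K \<and> c Q \<in> ball (k Q) (\<delta> n / 2)" for Q
    unfolding k_def by (rule someI_ex) (use K(2) in blast)
  have "inj_on k (\<Q> n)"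
  proof (rule inj_onI)
    fix P Q assume PQ: "P \<in> \<Q> n" "Q \<in> \<Q> n" "k P = k Q"
    have "dist (c P) (c Q) < \<delta> n / 2 + \<delta> n / 2"
      using k[of P] k[of Q] PQ(3) dist_triangle_less_add[of "c P" "k P" "\<delta> n / 2" "c Q" "\<delta> n / 2"]
      by (auto simp: dist_commute)
    then have "c Q \<in> P" using c[OF PQ(1)] by auto
    moreover have "c Q \<in> Q" using c[OF PQ(2)] d by auto
    ultimately show "P = Q" using disjointD[OF dj PQ(1,2)] by auto
  qed
  then show ?thesis
    using K(1) k by (meson finite_imageD finite_subset image_subsetI)
qed

lemma general_filtration_borel:
  fixes E :: "'a::metric_space set"
  assumes X: "compact (UNIV :: 'a set)" and F: "general_filtration E \<delta> \<gamma> \<Q>"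
  shows "E \<in> sets borel"
proof -
  have "\<Union>(\<Q> n) \<in> sets borel" for n
    using general_filtration_finite[OF X F] F
    by (intro sets.finite_Union) (auto simp: general_filtration_def)
  then show ?thesis using F by (auto simp: general_filtration_def)
qed

text \<open>The domain may be larger than the Borel sets, so that the restriction of a Borel regular
  outer measure to its Caratheodory measurable sets is covered as well.\<close>

definition borel_regular :: "'a::topological_space measure \<Rightarrow> bool" where
  "borel_regular \<mu> \<longleftrightarrow> sets borel \<subseteq> sets \<mu> \<and> space \<mu> = UNIV \<and>
     (\<forall>A\<in>sets \<mu>. \<exists>B\<in>sets borel. A \<subseteq> B \<and> emeasure \<mu> B = emeasure \<mu> A)"

text \<open>\<open>d(x,y)\<^sup>-\<^sup>s\<close> with values in \<open>[0,\<infinity>]\<close>: it is \<open>1\<close> for \<open>s = 0\<close>, and \<open>\<infinity>\<close> on the diagonal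
  for \<open>s > 0\<close> (whereas \<open>0 powr (-s) = 0\<close>).\<close>

definition riesz_kernel :: "real \<Rightarrow> 'a::metric_space \<Rightarrow> 'a \<Rightarrow> ennreal" where
  "riesz_kernel s x y =
     (if s = 0 then 1 else if x = y then \<infinity> else ennreal (dist x y powr (- s)))"

definition energy :: "'a::metric_space measure \<Rightarrow> real \<Rightarrow> ennreal" where
  "energy \<mu> s = (\<integral>\<^sup>+ y. (\<integral>\<^sup>+ x. riesz_kernel s x y \<partial>\<mu>) \<partial>\<mu>)"

text \<open>The value is \<open>\<infinity>\<close> if all energies are finite, e.g. for \<open>\<mu> = 0\<close>.\<close>

definition dim_cor :: "'a::metric_space measure \<Rightarrow> ereal" where
  "dim_cor \<mu> = Inf {ereal s | s. 0 \<le> s \<and> energy \<mu> s = \<infinity>}"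

text \<open>Logarithm on \<open>[0,\<infinity>)\<close> with \<open>log 0 = -\<infinity>\<close>.\<close>

definition ext_ln :: "real \<Rightarrow> ereal" where
  "ext_ln t = (if t = 0 then -\<infinity> else ereal (ln t))"

end

theory Submission
  imports Defs
begin

text \<open>Write \<open>S n\<close> for the sum of the \<open>\<mu>(Q)\<^sup>2\<close>. Restricting the energy integral to the squares
  \<open>Q \<times> Q\<close> gives \<open>S n \<le> (2 \<gamma> n)\<^sup>s I\<^sub>s(\<mu>)\<close>, so every \<open>s\<close> of finite energy is at most the lower limit.
  Conversely, by doubling each \<open>Q\<close> lies within \<open>\<delta> n\<close> of at most \<open>A (\<gamma> n / \<delta> n)\<^sup>a\<close> members of
  \<open>\<Q> n\<close>, and this is at most \<open>A \<delta> n\<^sup>-\<^sup>\<epsilon>\<close> up to renaming \<open>\<epsilon>\<close>. Hence the \<open>\<mu> \<times> \<mu>\<close>-measure of the pairs at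
  distance at most \<open>\<delta> n\<close> is at most \<open>A \<delta> n\<^sup>-\<^sup>\<epsilon> S n\<close>. If \<open>s\<close> is below the lower limit, then, because
  consecutive \<open>\<delta> n\<close> are logarithmically comparable, the pairs at distance at most \<open>r\<close> have measure
  at most \<open>A r\<^sup>u\<close> with \<open>u > s\<close>, and summing over dyadic \<open>r\<close> bounds the energy. The detour through
  dyadic radii is needed since \<open>\<delta> n\<close> may tend to \<open>0\<close> so slowly that no \<open>\<Sum>n. \<delta> n\<^sup>\<eta>\<close> converges.\<close>

section \<open>Scales and covering numbers\<close>

text \<open>The first index at which the sequence drops below \<open>r\<close> is
  \<open>Suc n\<close>; the condition \<open>r \<le> \<delta> m\<close> forces it beyond
  \<open>m\<close>. This is used both for the scales of the filtration and for the powers of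
  \<open>1/2\<close>.\<close>

lemma decseq_tendsto_0_scale:
  fixes \<delta> :: "nat \<Rightarrow> real"
  assumes "\<delta> \<longlonglongrightarrow> 0" "decseq \<delta>" "0 < r" "r \<le> \<delta> m"
  obtains n where "m \<le> n" "\<delta> (Suc n) < r" "r \<le> \<delta> n"
proof -
  have "\<forall>\<^sub>F n in sequentially. \<delta> n < r"
    using assms(1,3) by (rule order_tendstoD)
  then have ex: "\<exists>n. \<delta> n < r"
    by (auto simp: eventually_sequentially)
  define k where "k = (LEAST n. \<delta> n < r)"
  have k: "\<delta> k < r"
    unfolding k_def by (rule LeastI_ex[OF ex])
  have k': "r \<le> \<delta> j" if "j < k" for j
    using not_less_Least[of j "\<lambda>n. \<delta> n < r"] that by (simp add: k_def)
  have "m < k"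
    using decseqD[OF assms(2), of k m] k assms(4) by linarith
  then obtain n where "k = Suc n" "m \<le> n"
    by (cases k) auto
  with k k' that show thesis
    by auto
qed

text \<open>Each halving of the radius replaces every ball by at most \<open>N\<close> smaller ones.
  The bound \<open>1 \<le> N\<close>, which holds because a ball contains its centre, allows taking
  the logarithm of \<open>N\<close> later.\<close>

lemma doubling_space_iterated_cover:
  assumes "doubling_space TYPE('a::metric_space)"
  obtains N :: nat where "1 \<le> N"
    "\<And>(x::'a) r k. 0 < r \<Longrightarrow>
       \<exists>C. finite C \<and> card C \<le> N ^ k \<and> cball x r \<subseteq> (\<Union>c\<in>C. cball c (r / 2 ^ k))"
proof -
  obtain N :: nat where N: "\<And>(x::'a) r. 0 < r \<Longrightarrow>
      \<exists>C. finite C \<and> card C \<le> N \<and> cball x r \<subseteq> (\<Union>c\<in>C. cball c (r / 2))"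
    using assms unfolding doubling_space_def by blast
  have "1 \<le> N"
  proof -
    obtain C where C: "finite C" "card C \<le> N"
      "cball (undefined::'a) 1 \<subseteq> (\<Union>c\<in>C. cball c (1 / 2))"
      using N[of 1 undefined] by auto
    have "undefined \<in> cball (undefined::'a) 1"
      by simp
    with C(3) have "C \<noteq> {}"
      by blast
    with C(1) have "card C \<noteq> 0"
      by auto
    with C(2) show ?thesis
      by linarith
  qed
  moreover have "\<exists>C. finite C \<and> card C \<le> N ^ k \<and> cball x r \<subseteq> (\<Union>c\<in>C. cball c (r / 2 ^ k))"
    if "0 < r" for x :: 'a and r k
  proof (induction k)
    case 0
    show ?case
      by (rule exI[of _ "{x}"]) simp
  next
    case (Suc k)
    then obtain C where C: "finite C" "card C \<le> N ^ k" "cball x r \<subseteq> (\<Union>c\<in>C. cball c (r / 2 ^ k))"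
      by blast
    have "\<forall>c::'a. \<exists>D. finite D \<and> card D \<le> N \<and>
        cball c (r / 2 ^ k) \<subseteq> (\<Union>d\<in>D. cball d (r / 2 ^ k / 2))"
      using that by (intro allI N) auto
    then obtain D where D: "\<And>c::'a. finite (D c)" "\<And>c. card (D c) \<le> N"
      "\<And>c. cball c (r / 2 ^ k) \<subseteq> (\<Union>d\<in>D c. cball d (r / 2 ^ k / 2))"
      by metis
    have "card (\<Union>c\<in>C. D c) \<le> (\<Sum>c\<in>C. card (D c))"
      by (rule card_UN_le[OF C(1)])
    also have "\<dots> \<le> card C * N"
      using sum_bounded_above[of C "\<lambda>c. card (D c)" N] D(2) by simp
    also have "\<dots> \<le> N ^ Suc k"
      using C(2) by (simp add: mult.commute)
    finally have "card (\<Union>c\<in>C. D c) \<le> N ^ Suc k" .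
    moreover have "cball x r \<subseteq> (\<Union>d\<in>(\<Union>c\<in>C. D c). cball d (r / 2 ^ Suc k))"
    proof
      fix z assume "z \<in> cball x r"
      then obtain c where c: "c \<in> C" "z \<in> cball c (r / 2 ^ k)"
        using C(3) by blast
      then obtain d where "d \<in> D c" "z \<in> cball d (r / 2 ^ k / 2)"
        using D(3) by blast
      then show "z \<in> (\<Union>d\<in>(\<Union>c\<in>C. D c). cball d (r / 2 ^ Suc k))"
        using c(1) by (auto simp: mult.commute)
    qed
    ultimately show ?case
      using C(1) D(1) by blast
  qed
  ultimately show thesis
    by (rule that)
qed

text \<open>Cover the large ball by balls of radius at most \<open>\<rho> / 2\<close>; each of them
  holds at most one point of the separated set, so the points are no more numerous than the
  balls.\<close>

lemma doubling_space_separated_card: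
  assumes "doubling_space TYPE('a::metric_space)"
  obtains A a :: real where "0 < A" "0 < a"
    "\<And>(x::'a) R \<rho> P. \<lbrakk>0 < \<rho>; \<rho> \<le> R; P \<subseteq> cball x R;
       \<And>p q. \<lbrakk>p \<in> P; q \<in> P; p \<noteq> q\<rbrakk> \<Longrightarrow> \<rho> < dist p q\<rbrakk>
     \<Longrightarrow> real (card P) \<le> A * (R / \<rho>) powr a"
proof -
  obtain N :: nat where N: "1 \<le> N" "\<And>(x::'a) r k. 0 < r \<Longrightarrow>
      \<exists>C. finite C \<and> card C \<le> N ^ k \<and> cball x r \<subseteq> (\<Union>c\<in>C. cball c (r / 2 ^ k))"
    by (rule doubling_space_iterated_cover[OF assms]) (erule that, blast)
  \<comment> \<open>The summand \<open>1\<close> keeps the exponent positive even when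
    \<open>N = 1\<close>. Of its size only \<open>N \<le> 2 powr a\<close> matters.\<close>
  define a where "a = log 2 (real N) + 1"
  have a: "0 < a"
    using N(1) by (auto simp: a_def intro!: add_nonneg_pos)
  have Na: "real N \<le> 2 powr a"
    using N(1) by (simp add: a_def powr_add)
  have "real (card P) \<le> 4 powr a * (R / \<rho>) powr a"
    if \<rho>: "0 < \<rho>" "\<rho> \<le> R" and P: "P \<subseteq> cball x R"
      and sep: "\<And>p q. \<lbrakk>p \<in> P; q \<in> P; p \<noteq> q\<rbrakk> \<Longrightarrow> \<rho> < dist p q" for x :: 'a and R \<rho> P
  proof -
    \<comment> \<open>This is the least \<open>k\<close> with
      \<open>2 * R / \<rho> \<le> 2 ^ k\<close>: large enough to bring the radius
      \<open>R / 2 ^ k\<close> down to \<open>\<rho> / 2\<close>, and by minimality still with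
      \<open>2 ^ k \<le> 4 * (R / \<rho>)\<close>, whence the factor
      \<open>4 powr a\<close>.\<close>
    define k where "k = nat \<lceil>log 2 (2 * R / \<rho>)\<rceil>"
    have ge: "0 \<le> log 2 (2 * R / \<rho>)"
      using \<rho> by (subst zero_le_log_cancel_iff) (auto simp: field_simps)
    have kr: "real k = of_int \<lceil>log 2 (2 * R / \<rho>)\<rceil>"
      unfolding k_def using ge by simp
    have "log 2 (2 * R / \<rho>) \<le> real k" "real k \<le> log 2 (2 * R / \<rho>) + 1"
      unfolding kr by linarith+
    then have "2 powr log 2 (2 * R / \<rho>) \<le> 2 powr real k"
      "2 powr real k \<le> 2 powr (log 2 (2 * R / \<rho>) + 1)"
      by (auto intro: powr_mono)
    then have k: "2 * R / \<rho> \<le> 2 ^ k" "2 ^ k \<le> 4 * (R / \<rho>)"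
      using \<rho> by (auto simp: powr_add powr_realpow)
    obtain C where C: "finite C" "card C \<le> N ^ k" "cball x R \<subseteq> (\<Union>c\<in>C. cball c (R / 2 ^ k))"
      using N(2)[where r = R and x = x and k = k] \<rho> by auto
    have "\<forall>p\<in>P. \<exists>c\<in>C. p \<in> cball c (R / 2 ^ k)"
      using P C(3) by blast
    then obtain f where f: "\<And>p. p \<in> P \<Longrightarrow> f p \<in> C \<and> p \<in> cball (f p) (R / 2 ^ k)"
      by metis
    have rad: "R / 2 ^ k \<le> \<rho> / 2"
      using k(1) \<rho>(1) by (simp add: field_simps)
    have "inj_on f P"
    proof (rule inj_onI, rule ccontr)
      fix p q assume pq: "p \<in> P" "q \<in> P" "f p = f q" "p \<noteq> q"
      have "dist p q \<le> dist p (f p) + dist (f p) q"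
        by (rule dist_triangle)
      also have "\<dots> \<le> R / 2 ^ k + R / 2 ^ k"
        using f[OF pq(1)] f[OF pq(2)] pq(3) by (intro add_mono) (auto simp: dist_commute)
      also have "\<dots> \<le> \<rho> / 2 + \<rho> / 2"
        by (intro add_mono rad)
      finally show False
        using sep[OF pq(1,2,4)] by simp
    qed
    then have "card P \<le> card C"
      using f C(1) by (intro card_inj_on_le[of f]) auto
    then have "real (card P) \<le> real N ^ k"
      using C(2) by (metis of_nat_le_iff of_nat_power order_trans)
    also have "\<dots> \<le> (2 powr a) ^ k"
      using Na by (intro power_mono) auto
    also have "\<dots> = (2 ^ k) powr a"
      by (simp add: powr_realpow[symmetric] powr_powr mult.commute)
    also have "\<dots> \<le> (4 * (R / \<rho>)) powr a"
      using k(2) a by (intro powr_mono2) auto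
    also have "\<dots> = 4 powr a * (R / \<rho>) powr a"
      by (rule powr_mult)
    finally show ?thesis .
  qed
  with a that[of "4 powr a" a] show thesis
    by auto
qed

section \<open>Neighbouring members of a collection\<close>

text \<open>Bound each product by half the sum of the two squares. By symmetry of \<open>R\<close>
  both halves have the same total, in which the square at \<open>a\<close> occurs once for each
  neighbour of \<open>a\<close>.\<close>

lemma sum_symmetric_relation_le:
  fixes f :: "'b \<Rightarrow> real"
  assumes A: "finite A" and sym: "\<And>a b. R a b \<longleftrightarrow> R b a"
    and M: "\<And>a. a \<in> A \<Longrightarrow> real (card {b\<in>A. R a b}) \<le> M"
  shows "(\<Sum>a\<in>A. \<Sum>b\<in>{b\<in>A. R a b}. f a * f b) \<le> M * (\<Sum>a\<in>A. (f a)\<^sup>2)"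
proof -
  let ?T = "\<Sum>a\<in>A. \<Sum>b\<in>{b\<in>A. R a b}. (f a)\<^sup>2"
  have "(\<Sum>a\<in>A. \<Sum>b\<in>{b\<in>A. R a b}. (f b)\<^sup>2) = (\<Sum>b\<in>A. \<Sum>a\<in>{a\<in>A. R a b}. (f b)\<^sup>2)"
    by (rule sum.swap_restrict[OF A A])
  also have "\<dots> = ?T"
    using sym by (intro sum.cong refl) auto
  finally have swap: "(\<Sum>a\<in>A. \<Sum>b\<in>{b\<in>A. R a b}. (f b)\<^sup>2) = ?T" .
  have "(\<Sum>a\<in>A. \<Sum>b\<in>{b\<in>A. R a b}. f a * f b)
      \<le> (\<Sum>a\<in>A. \<Sum>b\<in>{b\<in>A. R a b}. (f a)\<^sup>2 / 2 + (f b)\<^sup>2 / 2)"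
  proof (intro sum_mono)
    fix a b
    have "0 \<le> (f a - f b)\<^sup>2"
      by simp
    then show "f a * f b \<le> (f a)\<^sup>2 / 2 + (f b)\<^sup>2 / 2"
      by (simp add: power2_diff)
  qed
  also have "\<dots> = ?T / 2 + ?T / 2"
    using swap by (simp add: sum.distrib flip: sum_divide_distrib)
  also have "\<dots> = (\<Sum>a\<in>A. real (card {b\<in>A. R a b}) * (f a)\<^sup>2)"
    by simp
  also have "\<dots> \<le> (\<Sum>a\<in>A. M * (f a)\<^sup>2)"
    using M by (intro sum_mono mult_right_mono) auto
  finally show ?thesis
    by (simp add: sum_distrib_left)
qed

text \<open>Members are counted by the centres of their inner balls. Disjointness puts these centres
  more than \<open>\<delta> n\<close> apart, and those of the neighbours of \<open>Q\<close> lie in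
  one ball of radius comparable to \<open>\<gamma> n\<close>. The constants are uniform in
  \<open>n\<close> and \<open>Q\<close>.\<close>

lemma general_filtration_neighbours_card:
  fixes E :: "'a::metric_space set"
  assumes D: "doubling_space TYPE('a)" and F: "general_filtration E \<delta> \<gamma> \<Q>"
  obtains A a :: real where "0 < A" "0 < a"
    "\<And>n Q. Q \<in> \<Q> n
      \<Longrightarrow> real (card {P\<in>\<Q> n. \<exists>x\<in>Q. \<exists>y\<in>P. dist x y \<le> \<delta> n}) \<le> A * (\<gamma> n / \<delta> n) powr a"
proof -
  obtain A a where Aa: "0 < A" "0 < a" and sep: "\<And>(x::'a) R \<rho> P. \<lbrakk>0 < \<rho>; \<rho> \<le> R; P \<subseteq> cball x R;
       \<And>p q. \<lbrakk>p \<in> P; q \<in> P; p \<noteq> q\<rbrakk> \<Longrightarrow> \<rho> < dist p q\<rbrakk>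
     \<Longrightarrow> real (card P) \<le> A * (R / \<rho>) powr a"
    using doubling_space_separated_card[OF D] by metis
  have "real (card {P\<in>\<Q> n. \<exists>x\<in>Q. \<exists>y\<in>P. dist x y \<le> \<delta> n}) \<le> A * 4 powr a * (\<gamma> n / \<delta> n) powr a"
    if Q: "Q \<in> \<Q> n" for n Q
  proof -
    let ?P = "{P\<in>\<Q> n. \<exists>x\<in>Q. \<exists>y\<in>P. dist x y \<le> \<delta> n}"
    have d: "0 < \<delta> n" "\<delta> n \<le> \<gamma> n" "disjoint (\<Q> n)"
      and inn: "\<forall>P\<in>\<Q> n. \<exists>x. cball x (\<delta> n) \<subseteq> P"
      and out: "\<And>P. P \<in> \<Q> n \<Longrightarrow> \<exists>x. P \<subseteq> cball x (\<gamma> n)"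
      using F by (auto simp: general_filtration_def)
    obtain c where c: "\<And>P. P \<in> \<Q> n \<Longrightarrow> cball (c P) (\<delta> n) \<subseteq> P"
      using inn by metis
    obtain z where z: "Q \<subseteq> cball z (\<gamma> n)"
      using out[OF Q] by blast
    have far: "\<delta> n < dist (c P) (c P')" if "P \<in> \<Q> n" "P' \<in> \<Q> n" "P \<noteq> P'" for P P'
    proof (rule ccontr)
      assume "\<not> ?thesis"
      then have "c P' \<in> P"
        using c[OF that(1)] by auto
      moreover have "c P' \<in> P'"
        using c[OF that(2)] d by auto
      ultimately show False
        using disjointD[OF d(3) that] by blast
    qed
    have "inj_on c ?P"
      using far d(1) by (intro inj_onI) (metis (no_types, lifting) dist_self mem_Collect_eq not_less_iff_gr_or_eq)
    then have "real (card ?P) = real (card (c ` ?P))"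
      by (simp add: card_image)
    also have "\<dots> \<le> A * (4 * \<gamma> n / \<delta> n) powr a"
    proof (rule sep[where x = z])
      \<comment> \<open>The factor \<open>4\<close> adds up one \<open>\<gamma> n\<close> from
        \<open>z\<close> to \<open>x\<close>, at most \<open>\<delta> n \<le> \<gamma> n\<close>
        from \<open>x\<close> to \<open>y\<close>, and two \<open>\<gamma> n\<close> from
        \<open>y\<close> to \<open>c P\<close> through the centre \<open>w\<close> of the outer
        ball.\<close>
      show "c ` ?P \<subseteq> cball z (4 * \<gamma> n)"
      proof safe
        fix P x y assume P: "P \<in> \<Q> n" "x \<in> Q" "y \<in> P" "dist x y \<le> \<delta> n"
        obtain w where w: "P \<subseteq> cball w (\<gamma> n)"
          using out[OF P(1)] by blast
        have "c P \<in> P"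
          using c[OF P(1)] d by auto
        then have "dist w (c P) \<le> \<gamma> n" "dist w y \<le> \<gamma> n" "dist z x \<le> \<gamma> n"
          using w z P by auto
        moreover have "dist z (c P) \<le> dist z x + dist x y + dist w y + dist w (c P)"
          by metric
        ultimately show "c P \<in> cball z (4 * \<gamma> n)"
          using P(4) d by simp
      qed
      show "\<delta> n < dist p q" if "p \<in> c ` ?P" "q \<in> c ` ?P" "p \<noteq> q" for p q
        using that far by auto
    qed (use d in auto)
    also have "(4 * \<gamma> n / \<delta> n) powr a = 4 powr a * (\<gamma> n / \<delta> n) powr a"
      using d powr_mult[of 4 "\<gamma> n / \<delta> n" a] by simp
    finally show ?thesis
      by (simp add: mult.assoc)
  qed
  with Aa that[of "A * 4 powr a" a] show thesis
    by auto
qed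

section \<open>Energy estimates by dyadic balls\<close>

text \<open>On the diagonal every summand is at least \<open>1\<close>, so the right-hand side is \<open>\<infinity>\<close> there and the
  diagonal needs no separate treatment.\<close>

lemma riesz_kernel_le_dyadic_sum:
  fixes x y :: "'a::metric_space"
  assumes "0 \<le> s"
  shows "riesz_kernel s x y \<le> ennreal (((1/2) ^ m) powr (- s)) +
    (\<Sum>k. ennreal (((1/2) ^ Suc (k + m)) powr (- s)) * indicator (cball y ((1/2) ^ (k + m))) x)"
    (is "_ \<le> ennreal ?A + (\<Sum>k. ?f k)")
proof -
  have one: "1 \<le> ennreal (((1/2) ^ k) powr (- s))" for k
  proof -
    have "(1::real) powr (- s) \<le> ((1/2) ^ k) powr (- s)"
      using assms by (intro powr_mono2') (auto simp: power_le_one)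
    then show ?thesis
      by simp
  qed
  consider "s = 0" | "0 < s" "x = y" | "0 < s" "x \<noteq> y" "(1/2) ^ m \<le> dist x y"
    | "0 < s" "x \<noteq> y" "dist x y \<le> (1/2) ^ m"
    using assms by linarith
  then show ?thesis
  proof cases
    case 1
    then show ?thesis
      by (auto simp: riesz_kernel_def intro!: add_increasing2)
  next
    case 2
    have "of_nat n \<le> (\<Sum>k. ?f k)" for n
    proof -
      have "(of_nat n :: ennreal) = (\<Sum>k<n. 1)"
        by simp
      also have "\<dots> \<le> (\<Sum>k<n. ?f k)"
      proof (intro sum_mono)
        fix k
        show "1 \<le> ?f k"
          using 2 one[of "Suc (k + m)"] by (simp del: power_Suc)
      qed
      also have "\<dots> \<le> (\<Sum>k. ?f k)"
        by (intro sum_le_suminf) auto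
      finally show ?thesis .
    qed
    then have "(SUP n. of_nat n :: ennreal) \<le> (\<Sum>k. ?f k)"
      by (intro SUP_least)
    then have "(\<Sum>k. ?f k) = top"
      by (simp add: ennreal_SUP_of_nat_eq_top top_unique)
    then show ?thesis
      by simp
  next
    case 3
    then have "dist x y powr (- s) \<le> ?A"
      by (intro powr_mono2') auto
    then have "riesz_kernel s x y \<le> ennreal ?A"
      using 3 by (auto simp: riesz_kernel_def intro: ennreal_leI)
    then show ?thesis
      by (intro add_increasing2) auto
  next
    case 4
    \<comment> \<open>At the dyadic scale of the distance a single summand dominates: its indicator
      uses the larger radius \<open>(1/2) ^ n\<close>, so that it contains the pair, and its weight
      the smaller \<open>(1/2) ^ Suc n\<close>, so that it exceeds the kernel.\<close>
    obtain n where n: "m \<le> n" "(1/2) ^ Suc n < dist x y" "dist x y \<le> (1/2) ^ n"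
    proof (rule decseq_tendsto_0_scale[of "\<lambda>n. (1/2) ^ n" "dist x y" m])
      show "(\<lambda>n. (1/2) ^ n :: real) \<longlonglongrightarrow> 0"
        by (rule LIMSEQ_power_zero) simp
      show "decseq (\<lambda>n. (1/2) ^ n :: real)"
        by (intro decseq_SucI) simp
    qed (use 4 in auto)
    have "dist x y powr (- s) \<le> ((1/2) ^ Suc n) powr (- s)"
      using 4 n by (intro powr_mono2') auto
    then have "riesz_kernel s x y \<le> ?f (n - m)"
      using 4 n by (auto simp: riesz_kernel_def dist_commute intro: ennreal_leI)
    also have "\<dots> = sum ?f {n - m}"
      by (simp only: sum.insert finite.emptyI empty_iff not_False_eq_True sum.empty add_0_right)
    also have "\<dots> \<le> (\<Sum>k. ?f k)"
      by (intro sum_le_suminf) auto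
    finally show ?thesis
      by (intro add_increasing) auto
  qed
qed

text \<open>The majorants \<open>g k\<close> spare us the measurability of \<open>y \<mapsto> \<mu>(cball y r)\<close>.\<close>

lemma energy_finite_dyadic:
  fixes \<mu> :: "'a::metric_space measure"
  assumes \<mu>: "finite_measure \<mu>" "sets borel \<subseteq> sets \<mu>" "space \<mu> = UNIV"
    and su: "0 \<le> s" "s < u" and C: "0 \<le> C"
    and g: "\<And>k. m \<le> k \<Longrightarrow> g k \<in> borel_measurable \<mu>"
    and ball: "\<And>k. m \<le> k \<Longrightarrow> AE y in \<mu>. emeasure \<mu> (cball y ((1/2) ^ k)) \<le> g k y"
    and int: "\<And>k. m \<le> k \<Longrightarrow> (\<integral>\<^sup>+ y. g k y \<partial>\<mu>) \<le> ennreal (C * ((1/2) ^ k) powr u)"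
  shows "energy \<mu> s < \<infinity>"
proof -
  interpret finite_measure \<mu> by fact
  define A where "A = ennreal (((1/2) ^ m) powr (- s))"
  define c where "c k = ((1/2) ^ Suc (k + m)) powr (- s)" for k
  define M where "M = emeasure \<mu> UNIV"
  have M: "M < \<infinity>"
    unfolding M_def infinity_ennreal_def less_top[symmetric] by (rule emeasure_finite)
  have cb: "cball y r \<in> sets \<mu>" for y r
    using \<mu>(2) by auto
  have g': "g (k + m) \<in> borel_measurable \<mu>" for k
    by (rule g) simp
  have inner: "(\<integral>\<^sup>+ x. riesz_kernel s x y \<partial>\<mu>)
      \<le> A * M + (\<Sum>k. ennreal (c k) * emeasure \<mu> (cball y ((1/2) ^ (k + m))))" for y
  proof -
    have "(\<integral>\<^sup>+ x. riesz_kernel s x y \<partial>\<mu>)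
        \<le> (\<integral>\<^sup>+ x. A + (\<Sum>k. ennreal (c k) * indicator (cball y ((1/2) ^ (k + m))) x) \<partial>\<mu>)"
      unfolding A_def c_def by (intro nn_integral_mono riesz_kernel_le_dyadic_sum su)
    also have "\<dots> = A * M + (\<Sum>k. ennreal (c k) * emeasure \<mu> (cball y ((1/2) ^ (k + m))))"
      using cb by (simp add: nn_integral_add nn_integral_suminf nn_integral_cmult M_def \<mu>(3))
    finally show ?thesis .
  qed
  \<comment> \<open>The countably many exceptional null sets are merged into one, outside which the
    bounds can be summed over all \<open>k\<close>.\<close>
  have "AE y in \<mu>. \<forall>k. emeasure \<mu> (cball y ((1/2) ^ (k + m))) \<le> g (k + m) y"
    unfolding AE_all_countable using ball by simp
  then have "energy \<mu> s \<le> (\<integral>\<^sup>+ y. A * M + (\<Sum>k. ennreal (c k) * g (k + m) y) \<partial>\<mu>)"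
    unfolding energy_def
    by (intro nn_integral_mono_AE) (elim eventually_mono, rule order_trans[OF inner],
        intro add_left_mono suminf_le mult_left_mono, auto)
  also have "\<dots> = A * M * M + (\<Sum>k. ennreal (c k) * (\<integral>\<^sup>+ y. g (k + m) y \<partial>\<mu>))"
    using g' by (simp add: nn_integral_add nn_integral_suminf nn_integral_cmult M_def \<mu>(3))
  also have "\<dots> \<le> A * M * M + (\<Sum>k. ennreal (c k * (C * ((1/2) ^ (k + m)) powr u)))"
  proof (intro add_left_mono suminf_le)
    fix k
    have "ennreal (c k) * (\<integral>\<^sup>+ y. g (k + m) y \<partial>\<mu>) \<le> ennreal (c k) * ennreal (C * ((1/2) ^ (k + m)) powr u)"
      by (intro mult_left_mono int) auto
    then show "ennreal (c k) * (\<integral>\<^sup>+ y. g (k + m) y \<partial>\<mu>) \<le> ennreal (c k * (C * ((1/2) ^ (k + m)) powr u))"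
      by (simp add: ennreal_mult' c_def)
  qed auto
  also have "\<dots> < \<infinity>"
  proof -
    \<comment> \<open>The terms form a geometric series with ratio
      \<open>(1/2) powr (u - s)\<close>, which is below \<open>1\<close> because
      \<open>s < u\<close>.\<close>
    have eq: "c k * (C * ((1/2) ^ (k + m)) powr u)
        = C * (1/2) powr (m * (u - s) - s) * ((1/2) powr (u - s)) ^ k" for k
    proof -
      have "c k = (1/2) powr (- s * Suc (k + m))"
        by (simp only: c_def powr_realpow[symmetric] powr_powr) (simp add: powr_powr mult.commute)
      moreover have "((1/2) ^ (k + m)) powr u = (1/2::real) powr (u * (k + m))"
        by (simp add: powr_realpow[symmetric] powr_powr mult.commute del: of_nat_add)
      moreover have "((1/2) powr (u - s)) ^ k = (1/2::real) powr ((u - s) * k)"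
        by (simp add: powr_realpow[symmetric] powr_powr)
      ultimately show ?thesis
        by (simp add: powr_add[symmetric] algebra_simps)
    qed
    have "(1/2::real) powr (u - s) < 1 powr (u - s)"
      using su by (intro powr_less_mono2) auto
    then have "summable (\<lambda>k. c k * (C * ((1/2) ^ (k + m)) powr u))"
      unfolding eq by (intro summable_mult summable_geometric) simp
    then have "(\<Sum>k. ennreal (c k * (C * ((1/2) ^ (k + m)) powr u))) < \<infinity>"
      using C by (subst suminf_ennreal2) (auto simp: c_def)
    moreover have "A * M * M < \<infinity>"
      using M by (simp add: A_def ennreal_mult_less_top)
    ultimately show ?thesis
      by simp
  qed
  finally show ?thesis .
qed

section \<open>From decay of the sums of squares to finite energy\<close>

text \<open>For \<open>y\<close> in \<open>E\<close> and in the member \<open>Q\<close>, the part of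
  the ball inside \<open>E\<close> is covered by the neighbours of \<open>Q\<close>, whose total
  mass is \<open>h Q\<close>. The step function with value \<open>h Q\<close> on \<open>Q\<close> is
  therefore a majorant, and its integral is a sum of products of masses over neighbouring pairs, to
  which \<open>sum_symmetric_relation_le\<close> applies.\<close>

lemma general_filtration_ball_majorant:
  fixes \<mu> :: "'a::metric_space measure"
  assumes X: "compact (UNIV :: 'a set)" and F: "general_filtration E \<delta> \<gamma> \<Q>"
    and \<mu>: "finite_measure \<mu>" "sets borel \<subseteq> sets \<mu>" "space \<mu> = UNIV"
    and E: "emeasure \<mu> (UNIV - E) = 0"
    and M: "\<And>Q. Q \<in> \<Q> n \<Longrightarrow> real (card {P\<in>\<Q> n. \<exists>x\<in>Q. \<exists>y\<in>P. dist x y \<le> \<delta> n}) \<le> M"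
  obtains g where "g \<in> borel_measurable \<mu>"
    "AE y in \<mu>. emeasure \<mu> (cball y (\<delta> n)) \<le> g y"
    "(\<integral>\<^sup>+ y. g y \<partial>\<mu>) \<le> ennreal (M * (\<Sum>Q\<in>\<Q> n. (measure \<mu> Q)\<^sup>2))"
proof
  interpret finite_measure \<mu> by fact
  have fin: "finite (\<Q> n)"
    by (rule general_filtration_finite[OF X F])
  have Qs: "Q \<in> sets \<mu>" if "Q \<in> \<Q> n" for Q
    using F that \<mu>(2) by (auto simp: general_filtration_def)
  have Es: "E \<in> sets \<mu>"
    using general_filtration_borel[OF X F] \<mu>(2) by blast
  then have Es': "UNIV - E \<in> sets \<mu>"
    using \<mu>(3) by (metis sets.compl_sets)
  have EQ: "E \<subseteq> \<Union>(\<Q> n)"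
    using F by (auto simp: general_filtration_def)
  define R where "R Q P \<longleftrightarrow> (\<exists>x\<in>Q. \<exists>y\<in>P. dist x y \<le> \<delta> n)" for Q P :: "'a set"
  have R_sym: "R Q P \<longleftrightarrow> R P Q" for Q P
    unfolding R_def by (metis dist_commute)
  define h where "h Q = (\<Sum>P\<in>{P\<in>\<Q> n. R Q P}. measure \<mu> P)" for Q
  let ?g = "\<lambda>y. \<Sum>Q\<in>\<Q> n. ennreal (h Q) * indicator Q y"
  have h: "0 \<le> h Q" for Q
    by (simp add: h_def sum_nonneg)
  show "?g \<in> borel_measurable \<mu>"
    using Qs by (intro borel_measurable_sum borel_measurable_times borel_measurable_indicator) auto
  \<comment> \<open>The step function vanishes outside the union of \<open>\<Q> n\<close>, so the
    bound is proved on \<open>E\<close> only, which carries all the mass.\<close>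
  have "AE y in \<mu>. y \<in> E"
    by (rule AE_I'[of "UNIV - E"]) (use E Es' in \<open>auto simp: null_sets_def\<close>)
  then show "AE y in \<mu>. emeasure \<mu> (cball y (\<delta> n)) \<le> ?g y"
  proof (eventually_elim)
    fix y assume "y \<in> E"
    then obtain Q where Q: "Q \<in> \<Q> n" "y \<in> Q"
      using EQ by blast
    let ?N = "{P\<in>\<Q> n. R Q P}"
    have sub: "cball y (\<delta> n) \<subseteq> \<Union>?N \<union> (UNIV - E)"
      using EQ Q by (auto simp: R_def) (metis UnionE subsetD)
    have Ns: "\<Union>?N \<in> sets \<mu>"
      using fin Qs by (intro sets.finite_Union) auto
    have "emeasure \<mu> (cball y (\<delta> n)) \<le> emeasure \<mu> (\<Union>?N \<union> (UNIV - E))"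
      using sub Ns Es' by (intro emeasure_mono) auto
    also have "\<dots> \<le> emeasure \<mu> (\<Union>?N) + emeasure \<mu> (UNIV - E)"
      using Ns Es' by (rule emeasure_subadditive)
    also have "\<dots> = emeasure \<mu> (\<Union>P\<in>?N. P)"
      using E by simp
    also have "\<dots> \<le> (\<Sum>P\<in>?N. emeasure \<mu> P)"
      using fin Qs by (intro emeasure_subadditive_finite) auto
    also have "\<dots> = ennreal (h Q)"
      by (simp add: h_def emeasure_eq_measure)
    also have "\<dots> = ennreal (h Q) * indicator Q y"
      using Q by simp
    also have "\<dots> \<le> ?g y"
      using fin Q by (intro member_le_sum) auto
    finally show "emeasure \<mu> (cball y (\<delta> n)) \<le> ?g y" .
  qed
  have "(\<integral>\<^sup>+ y. ?g y \<partial>\<mu>) = (\<Sum>Q\<in>\<Q> n. ennreal (h Q) * emeasure \<mu> Q)"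
    using Qs by (subst nn_integral_sum) (auto intro!: sum.cong nn_integral_cmult_indicator)
  also have "\<dots> = ennreal (\<Sum>Q\<in>\<Q> n. h Q * measure \<mu> Q)"
    using h by (simp add: emeasure_eq_measure ennreal_mult'[symmetric])
  also have "(\<Sum>Q\<in>\<Q> n. h Q * measure \<mu> Q)
      = (\<Sum>Q\<in>\<Q> n. \<Sum>P\<in>{P\<in>\<Q> n. R Q P}. measure \<mu> Q * measure \<mu> P)"
    by (simp add: h_def sum_distrib_left mult.commute)
  also have "ennreal \<dots> \<le> ennreal (M * (\<Sum>Q\<in>\<Q> n. (measure \<mu> Q)\<^sup>2))"
    by (intro ennreal_leI sum_symmetric_relation_le fin R_sym) (simp add: R_def M)
  finally show "(\<integral>\<^sup>+ y. ?g y \<partial>\<mu>) \<le> ennreal (M * (\<Sum>Q\<in>\<Q> n. (measure \<mu> Q)\<^sup>2))" .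
qed

text \<open>Exponentiating turns the limits of quotients of logarithms into comparisons of powers.
  Once the scales are below \<open>1\<close> their logarithms are negative, so clearing a
  denominator reverses the inequality.\<close>

lemma general_filtration_eventually:
  assumes F: "general_filtration E \<delta> \<gamma> \<Q>"
  shows "\<delta> \<longlonglongrightarrow> 0"
    and "\<forall>\<^sub>F n in sequentially. \<delta> n < 1"
    and "0 < e \<Longrightarrow> \<forall>\<^sub>F n in sequentially. \<delta> n powr (1 + e) < \<delta> (Suc n)"
    and "0 < e \<Longrightarrow> \<forall>\<^sub>F n in sequentially. \<gamma> n / \<delta> n < \<delta> n powr (- e)"
proof -
  have pos: "\<And>n. 0 < \<delta> n" "\<And>n. 0 < \<gamma> n" and le: "\<And>n. \<delta> n \<le> \<gamma> n" and lim: "\<gamma> \<longlonglongrightarrow> 0"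
    and F3: "(\<lambda>n. ln (\<delta> n) / ln (\<delta> (Suc n))) \<longlonglongrightarrow> 1"
    and F4: "(\<lambda>n. ln (\<gamma> n) / ln (\<delta> n)) \<longlonglongrightarrow> 1"
    using F by (auto simp: general_filtration_def)
  show d0: "\<delta> \<longlonglongrightarrow> 0"
    by (rule tendsto_sandwich[OF _ _ tendsto_const lim]) (use pos le in \<open>auto intro!: always_eventually less_imp_le\<close>)
  show d1: "\<forall>\<^sub>F n in sequentially. \<delta> n < 1"
    by (rule order_tendstoD[OF d0]) simp
  show "\<forall>\<^sub>F n in sequentially. \<delta> n powr (1 + e) < \<delta> (Suc n)" if e: "0 < e"
  proof -
    have "\<forall>\<^sub>F n in sequentially. 1 / (1 + e) < ln (\<delta> n) / ln (\<delta> (Suc n))"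
      by (rule order_tendstoD[OF F3]) (use e in simp)
    moreover have "\<forall>\<^sub>F n in sequentially. \<delta> (Suc n) < 1"
      using d1 by (subst eventually_sequentially_Suc)
    ultimately show ?thesis
    proof eventually_elim
      case (elim n)
      have "ln (\<delta> (Suc n)) < 0"
        using elim pos by simp
      then have "(1 + e) * ln (\<delta> n) < ln (\<delta> (Suc n))"
        using elim e by (simp add: field_simps)
      then have "exp ((1 + e) * ln (\<delta> n)) < exp (ln (\<delta> (Suc n)))"
        by simp
      then show ?case
        using pos[of n] pos[of "Suc n"] by (simp add: powr_def)
    qed
  qed
  show "\<forall>\<^sub>F n in sequentially. \<gamma> n / \<delta> n < \<delta> n powr (- e)" if e: "0 < e"
  proof -
    have "\<forall>\<^sub>F n in sequentially. 1 - e < ln (\<gamma> n) / ln (\<delta> n)"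
      by (rule order_tendstoD[OF F4]) (use e in simp)
    then show ?thesis
      using d1
    proof eventually_elim
      case (elim n)
      have "ln (\<delta> n) < 0"
        using elim pos by simp
      then have "ln (\<gamma> n) - ln (\<delta> n) < - e * ln (\<delta> n)"
        using elim by (simp add: field_simps)
      then have "exp (ln (\<gamma> n) - ln (\<delta> n)) < exp (- e * ln (\<delta> n))"
        by (simp only: exp_less_mono)
      then show ?case
        using pos[of n] by (simp add: powr_def exp_diff)
    qed
  qed
qed

text \<open>The gap between \<open>s\<close> and \<open>t\<close> pays for two losses: the number of
  neighbours costs a factor \<open>\<delta> n powr (- a * e)\<close>, and passing from
  \<open>\<delta> n\<close> to a radius between consecutive scales divides the exponent by
  \<open>1 + e\<close>.\<close>

lemma energy_finite_general_filtration:
  fixes \<mu> :: "'a::metric_space measure"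
  assumes X: "compact (UNIV :: 'a set)" and D: "doubling_space TYPE('a)"
    and F: "general_filtration E \<delta> \<gamma> \<Q>"
    and \<mu>: "finite_measure \<mu>" "sets borel \<subseteq> sets \<mu>" "space \<mu> = UNIV"
    and E: "emeasure \<mu> (UNIV - E) = 0"
    and st: "0 \<le> s" "s < t"
    and S: "\<forall>\<^sub>F n in sequentially. (\<Sum>Q\<in>\<Q> n. (measure \<mu> Q)\<^sup>2) \<le> \<delta> n powr t"
  shows "energy \<mu> s < \<infinity>"
proof -
  obtain A a where Aa: "0 < A" "0 < a" and nb: "\<And>n Q. Q \<in> \<Q> n
      \<Longrightarrow> real (card {P\<in>\<Q> n. \<exists>x\<in>Q. \<exists>y\<in>P. dist x y \<le> \<delta> n}) \<le> A * (\<gamma> n / \<delta> n) powr a"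
    by (rule general_filtration_neighbours_card[OF D F], rule that; blast)
  have pos: "\<And>n. 0 < \<delta> n" "\<And>n. 0 < \<gamma> n" and dec: "decseq \<delta>"
    using F by (auto simp: general_filtration_def)
  \<comment> \<open>With this choice the total loss \<open>e * (a + s)\<close> is half of
    \<open>t - s\<close>, which leaves \<open>s * (1 + e) < t - a * e\<close>.\<close>
  define e where "e = (t - s) / (2 * (a + s))"
  have e: "0 < e"
    using st Aa by (simp add: e_def)
  have "a + s \<noteq> 0"
    using st Aa by simp
  then have "e * (a + s) = (t - s) / 2"
    unfolding e_def by (simp add: divide_simps)
  then have et: "s * (1 + e) < t - a * e"
    using st by (simp add: algebra_simps)
  then have t': "0 \<le> t - a * e"
    using st e by (meson add_nonneg_nonneg less_imp_le mult_nonneg_nonneg order_trans zero_le_one)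
  \<comment> \<open>Chosen so that \<open>(\<delta> n powr (1 + e)) powr u\<close> equals
    \<open>\<delta> n powr (t - a * e)\<close>.\<close>
  define u where "u = (t - a * e) / (1 + e)"
  have u: "s < u"
    using et e by (simp add: u_def pos_less_divide_eq)
  obtain n0 where n0: "\<And>n. n0 \<le> n \<Longrightarrow> (\<Sum>Q\<in>\<Q> n. (measure \<mu> Q)\<^sup>2) \<le> \<delta> n powr t"
    "\<And>n. n0 \<le> n \<Longrightarrow> \<delta> n powr (1 + e) < \<delta> (Suc n)"
    "\<And>n. n0 \<le> n \<Longrightarrow> \<gamma> n / \<delta> n < \<delta> n powr (- e)"
    using eventually_conj[OF S eventually_conj[OF general_filtration_eventually(3)[OF F e] general_filtration_eventually(4)[OF F e]]]
    unfolding eventually_sequentially by blast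
  \<comment> \<open>Dyadic radii from index \<open>m\<close> on lie below
    \<open>\<delta> n0\<close>, so the scale matched to them has an index for which the three
    eventual estimates hold.\<close>
  have "\<forall>\<^sub>F k in sequentially. (1/2) ^ k < \<delta> n0"
    by (rule order_tendstoD[OF LIMSEQ_power_zero]) (use pos in auto)
  then obtain m where m: "\<And>k. m \<le> k \<Longrightarrow> (1/2) ^ k < \<delta> n0"
    unfolding eventually_sequentially by blast
  have "\<forall>k\<in>{m..}. \<exists>g. g \<in> borel_measurable \<mu> \<and>
      (AE y in \<mu>. emeasure \<mu> (cball y ((1/2) ^ k)) \<le> g y) \<and>
      (\<integral>\<^sup>+ y. g y \<partial>\<mu>) \<le> ennreal (A * ((1/2) ^ k) powr u)"
  proof
    fix k assume "k \<in> {m..}"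
    then have "(1/2) ^ k \<le> \<delta> n0"
      using m[of k] by simp
    then obtain n where n: "n0 \<le> n" "\<delta> (Suc n) < (1/2) ^ k" "(1/2) ^ k \<le> \<delta> n"
      using decseq_tendsto_0_scale[OF general_filtration_eventually(1)[OF F] dec, of "(1/2) ^ k" n0]
      by auto
    obtain g where g: "g \<in> borel_measurable \<mu>"
      "AE y in \<mu>. emeasure \<mu> (cball y (\<delta> n)) \<le> g y"
      "(\<integral>\<^sup>+ y. g y \<partial>\<mu>) \<le> ennreal (A * (\<gamma> n / \<delta> n) powr a * (\<Sum>Q\<in>\<Q> n. (measure \<mu> Q)\<^sup>2))"
      using general_filtration_ball_majorant[OF X F \<mu> E nb, of n] by blast
    have "AE y in \<mu>. emeasure \<mu> (cball y ((1/2) ^ k)) \<le> g y"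
      using g(2)
    proof eventually_elim
      fix y assume "emeasure \<mu> (cball y (\<delta> n)) \<le> g y"
      moreover have "emeasure \<mu> (cball y ((1/2) ^ k)) \<le> emeasure \<mu> (cball y (\<delta> n))"
        using n(3) \<mu>(2) by (intro emeasure_mono) auto
      ultimately show "emeasure \<mu> (cball y ((1/2) ^ k)) \<le> g y"
        by (rule order_trans[rotated])
    qed
    moreover have "A * (\<gamma> n / \<delta> n) powr a * (\<Sum>Q\<in>\<Q> n. (measure \<mu> Q)\<^sup>2) \<le> A * ((1/2) ^ k) powr u"
    proof -
      have "A * (\<gamma> n / \<delta> n) powr a * (\<Sum>Q\<in>\<Q> n. (measure \<mu> Q)\<^sup>2)
          \<le> A * (\<delta> n powr (- e)) powr a * \<delta> n powr t"
        using n0[OF n(1)] Aa pos[of n]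
        by (intro mult_mono powr_mono2 sum_nonneg) (auto intro!: divide_nonneg_pos less_imp_le[OF pos(2)])
      also have "\<dots> = A * \<delta> n powr (t - a * e)"
        by (simp add: powr_powr powr_add[symmetric] algebra_simps)
      also have "\<dots> = A * (\<delta> n powr (1 + e)) powr u"
        using e by (simp add: powr_powr u_def)
      \<comment> \<open>Here \<open>\<delta> n powr (1 + e) < \<delta> (Suc n) < (1/2) ^ k\<close>,
        and \<open>u\<close> is positive.\<close>
      also have "\<dots> \<le> A * ((1/2) ^ k) powr u"
        using n0(2)[OF n(1)] n(2) Aa u st by (intro mult_left_mono powr_mono2) auto
      finally show ?thesis .
    qed
    ultimately show "\<exists>g. g \<in> borel_measurable \<mu> \<and>
      (AE y in \<mu>. emeasure \<mu> (cball y ((1/2) ^ k)) \<le> g y) \<and>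
      (\<integral>\<^sup>+ y. g y \<partial>\<mu>) \<le> ennreal (A * ((1/2) ^ k) powr u)"
      using g(1,3) by (meson ennreal_leI order_trans)
  qed
  then obtain g where "\<forall>k\<in>{m..}. g k \<in> borel_measurable \<mu> \<and>
      (AE y in \<mu>. emeasure \<mu> (cball y ((1/2) ^ k)) \<le> g k y) \<and>
      (\<integral>\<^sup>+ y. g k y \<partial>\<mu>) \<le> ennreal (A * ((1/2) ^ k) powr u)"
    by (elim bchoice[elim_format] exE)
  then show ?thesis
    using Aa by (intro energy_finite_dyadic[OF \<mu> st(1) u, of A m g]) auto
qed

section \<open>From finite energy to decay of the sums of squares\<close>

text \<open>Two points of one member are at most \<open>2 * \<gamma> n\<close> apart, and by
  disjointness at most one member contains both. The kernel thus dominates the weighted sum of the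
  indicators of the squares pointwise, and the iterated integral of that sum is the left-hand
  side.\<close>

lemma energy_ge_sum_squares:
  fixes \<mu> :: "'a::metric_space measure"
  assumes X: "compact (UNIV :: 'a set)" and F: "general_filtration E \<delta> \<gamma> \<Q>"
    and \<mu>: "finite_measure \<mu>" "sets borel \<subseteq> sets \<mu>" and "0 \<le> s"
  shows "ennreal ((2 * \<gamma> n) powr (- s) * (\<Sum>Q\<in>\<Q> n. (measure \<mu> Q)\<^sup>2)) \<le> energy \<mu> s"
proof -
  interpret finite_measure \<mu> by fact
  let ?c = "(2 * \<gamma> n) powr (- s)"
  have fin: "finite (\<Q> n)"
    by (rule general_filtration_finite[OF X F])
  have dj: "disjoint (\<Q> n)"
    and out: "\<And>Q. Q \<in> \<Q> n \<Longrightarrow> \<exists>x. Q \<subseteq> cball x (\<gamma> n)"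
    using F by (auto simp: general_filtration_def)
  have Qs: "Q \<in> sets \<mu>" if "Q \<in> \<Q> n" for Q
    using F that \<mu>(2) by (auto simp: general_filtration_def)
  have pw: "(\<Sum>Q\<in>\<Q> n. ennreal ?c * indicator Q y * indicator Q x) \<le> riesz_kernel s x y" for x y
  proof (cases "\<exists>Q\<in>\<Q> n. x \<in> Q \<and> y \<in> Q")
    case True
    then obtain Q where Q: "Q \<in> \<Q> n" "x \<in> Q" "y \<in> Q"
      by blast
    have "x \<notin> P" if "P \<in> \<Q> n - {Q}" for P
      using disjointD[OF dj, of P Q] that Q by blast
    then have "(\<Sum>P\<in>\<Q> n - {Q}. ennreal ?c * indicator P y * indicator P x) = 0"
      by (intro sum.neutral) auto
    then have "(\<Sum>Q\<in>\<Q> n. ennreal ?c * indicator Q y * indicator Q x) = ennreal ?c"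
      using Q by (subst sum.remove[OF fin Q(1)]) simp
    moreover have "dist x y \<le> 2 * \<gamma> n"
    proof -
      obtain z where "Q \<subseteq> cball z (\<gamma> n)"
        using out[OF Q(1)] by blast
      then have "dist z x \<le> \<gamma> n" "dist z y \<le> \<gamma> n"
        using Q by auto
      then show ?thesis
        using dist_triangle3[of x y z] by linarith
    qed
    ultimately show ?thesis
      using \<open>0 \<le> s\<close> by (auto simp: riesz_kernel_def intro!: ennreal_leI powr_mono2')
  next
    case False
    then have "(\<Sum>Q\<in>\<Q> n. ennreal ?c * indicator Q y * indicator Q x) = 0"
      by (intro sum.neutral) (auto simp: indicator_def)
    then show ?thesis
      by (simp only: zero_le)
  qed
  have "ennreal (?c * (\<Sum>Q\<in>\<Q> n. (measure \<mu> Q)\<^sup>2))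
      = (\<Sum>Q\<in>\<Q> n. ennreal ?c * emeasure \<mu> Q * emeasure \<mu> Q)"
    by (simp add: emeasure_eq_measure ennreal_mult'[symmetric] sum_distrib_left power2_eq_square mult.assoc)
  also have "\<dots> = (\<integral>\<^sup>+ y. (\<integral>\<^sup>+ x. (\<Sum>Q\<in>\<Q> n. ennreal ?c * indicator Q y * indicator Q x) \<partial>\<mu>) \<partial>\<mu>)"
  proof -
    have "(\<integral>\<^sup>+ x. (\<Sum>Q\<in>\<Q> n. ennreal ?c * indicator Q y * indicator Q x) \<partial>\<mu>)
        = (\<Sum>Q\<in>\<Q> n. ennreal ?c * indicator Q y * emeasure \<mu> Q)" for y
      using Qs by (subst nn_integral_sum) (auto intro!: sum.cong nn_integral_cmult_indicator)
    moreover have "(\<Sum>Q\<in>\<Q> n. ennreal ?c * indicator Q y * emeasure \<mu> Q)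
        = (\<Sum>Q\<in>\<Q> n. ennreal ?c * emeasure \<mu> Q * indicator Q y)" for y
      by (simp add: ac_simps)
    moreover have "(\<integral>\<^sup>+ y. (\<Sum>Q\<in>\<Q> n. ennreal ?c * emeasure \<mu> Q * indicator Q y) \<partial>\<mu>)
        = (\<Sum>Q\<in>\<Q> n. ennreal ?c * emeasure \<mu> Q * emeasure \<mu> Q)"
      using Qs by (subst nn_integral_sum) (auto intro!: sum.cong simp: nn_integral_cmult_indicator)
    ultimately show ?thesis
      by simp
  qed
  also have "\<dots> \<le> energy \<mu> s"
    unfolding energy_def by (intro nn_integral_mono pw)
  finally show ?thesis .
qed

text \<open>Take logarithms in \<open>energy_ge_sum_squares\<close> and divide by the negative
  number \<open>ln (\<delta> n)\<close>. The constants disappear in the limit, and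
  \<open>ln (\<gamma> n) / ln (\<delta> n)\<close> tends to \<open>1\<close>.\<close>

lemma le_liminf_of_energy_finite:
  fixes \<mu> :: "'a::metric_space measure"
  assumes X: "compact (UNIV :: 'a set)" and F: "general_filtration E \<delta> \<gamma> \<Q>"
    and \<mu>: "finite_measure \<mu>" "sets borel \<subseteq> sets \<mu>"
    and s: "0 \<le> s" and fin: "energy \<mu> s < \<infinity>"
  shows "ereal s \<le> liminf (\<lambda>n. ext_ln (\<Sum>Q\<in>\<Q> n. (measure \<mu> Q)\<^sup>2) / ereal (ln (\<delta> n)))"
proof -
  let ?S = "\<lambda>n. \<Sum>Q\<in>\<Q> n. (measure \<mu> Q)\<^sup>2"
  have pos: "\<And>n. 0 < \<delta> n" "\<And>n. 0 < \<gamma> n"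
    and F4: "(\<lambda>n. ln (\<gamma> n) / ln (\<delta> n)) \<longlonglongrightarrow> 1"
    using F by (auto simp: general_filtration_def)
  obtain I where I: "energy \<mu> s = ennreal I" "0 \<le> I"
    using fin by (metis ennreal_cases less_irrefl infinity_ennreal_def)
  \<comment> \<open>Using \<open>I + 1\<close> instead of \<open>I\<close> keeps the argument of the
    logarithm positive in every case.\<close>
  define b where "b n = (ln (I + 1) + s * ln 2) * inverse (ln (\<delta> n)) + s * (ln (\<gamma> n) / ln (\<delta> n))" for n
  have "\<forall>\<^sub>F n in sequentially. ereal (b n) \<le> ext_ln (?S n) / ereal (ln (\<delta> n))"
    using general_filtration_eventually(2)[OF F]
  proof eventually_elim
    case (elim n)
    then have ln: "ln (\<delta> n) < 0"
      using pos by simp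
    show ?case
    proof (cases "?S n = 0")
      \<comment> \<open>A vanishing sum gives \<open>-\<infinity>\<close> divided by a negative
        number, that is \<open>\<infinity>\<close>.\<close>
      case True
      with ln show ?thesis
        by (simp add: ext_ln_def)
    next
      case False
      then have S: "0 < ?S n"
        by (simp add: sum_nonneg order_less_le)
      have "(2 * \<gamma> n) powr (- s) * ?S n \<le> I"
        using energy_ge_sum_squares[OF X F \<mu> s, of n] I by simp
      then have "?S n \<le> I * (2 * \<gamma> n) powr s"
        using pos(2)[of n] by (simp add: powr_minus field_simps)
      also have "\<dots> \<le> (I + 1) * (2 * \<gamma> n) powr s"
        by (intro mult_right_mono) auto
      finally have "ln (?S n) \<le> ln ((I + 1) * (2 * \<gamma> n) powr s)"
        using S by simp
      also have "\<dots> = ln (I + 1) + s * ln 2 + s * ln (\<gamma> n)"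
        using I pos(2)[of n] by (subst ln_mult) (auto simp: ln_mult algebra_simps)
      finally have "(ln (I + 1) + s * ln 2 + s * ln (\<gamma> n)) / ln (\<delta> n) \<le> ln (?S n) / ln (\<delta> n)"
        using ln by (intro divide_right_mono_neg) auto
      then show ?thesis
        using ln False by (simp add: ext_ln_def b_def field_simps)
    qed
  qed
  then have "liminf (\<lambda>n. ereal (b n)) \<le> liminf (\<lambda>n. ext_ln (?S n) / ereal (ln (\<delta> n)))"
    by (rule Liminf_mono)
  moreover have "b \<longlonglongrightarrow> s"
  proof -
    have "filterlim \<delta> (at_right 0) sequentially"
      using general_filtration_eventually(1)[OF F] pos
      by (intro tendsto_imp_filterlim_at_right) (auto intro!: always_eventually)
    then have "filterlim (\<lambda>n. ln (\<delta> n)) at_infinity sequentially"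
      by (intro filterlim_mono[OF filterlim_compose[OF ln_at_0] at_bot_le_at_infinity order_refl])
    then have "(\<lambda>n. inverse (ln (\<delta> n))) \<longlonglongrightarrow> 0"
      by (rule filterlim_compose[OF tendsto_inverse_0])
    then have "b \<longlonglongrightarrow> (ln (I + 1) + s * ln 2) * 0 + s * 1"
      unfolding b_def by (intro tendsto_intros F4)
    then show ?thesis
      by simp
  qed
  then have "liminf (\<lambda>n. ereal (b n)) = ereal s"
    by (intro lim_imp_Liminf) auto
  ultimately show ?thesis
    by simp
qed

section \<open>Equality of the dimension and the lower limit\<close>

theorem proposition2p3:
  fixes E :: "'a::metric_space set"
    and \<delta> \<gamma> :: "nat \<Rightarrow> real"
    and \<Q> :: "nat \<Rightarrow> 'a set set"
    and \<mu> :: "'a measure"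
  assumes "compact (UNIV :: 'a set)"
    and "doubling_space TYPE('a)"
    and "general_filtration E \<delta> \<gamma> \<Q>"
    and "finite_measure \<mu>"
    and "borel_regular \<mu>"
    and "emeasure \<mu> (UNIV - E) = 0"
  shows "dim_cor \<mu> =
    liminf (\<lambda>n. ext_ln (\<Sum>Q\<in>\<Q> n. (measure \<mu> Q)\<^sup>2) / ereal (ln (\<delta> n)))"
proof (rule antisym)
  let ?S = "\<lambda>n. \<Sum>Q\<in>\<Q> n. (measure \<mu> Q)\<^sup>2"
  let ?L = "liminf (\<lambda>n. ext_ln (?S n) / ereal (ln (\<delta> n)))"
  have sp: "sets borel \<subseteq> sets \<mu>" "space \<mu> = UNIV"
    using assms(5) by (auto simp: borel_regular_def)
  have low: "ereal s \<le> ?L" if "0 \<le> s" "energy \<mu> s < \<infinity>" for s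
    using le_liminf_of_energy_finite[OF assms(1,3,4) sp(1) that] .
  show "dim_cor \<mu> \<le> ?L"
  proof (rule ccontr)
    assume "\<not> ?thesis"
    then obtain t where t: "?L < ereal t" "ereal t < dim_cor \<mu>"
      by (meson ereal_dense2 not_le)
    \<comment> \<open>The energy at \<open>0\<close> is the squared total mass. Its finiteness makes
      the lower limit nonnegative, hence \<open>t\<close> positive and thus a competitor in the
      infimum that defines \<open>dim_cor\<close>.\<close>
    have "energy \<mu> 0 = emeasure \<mu> UNIV * emeasure \<mu> UNIV"
      using sp(2) by (simp add: energy_def riesz_kernel_def)
    then have "energy \<mu> 0 < \<infinity>"
      using finite_measure.emeasure_finite[OF assms(4), of UNIV]
      by (simp add: ennreal_mult_less_top less_top)
    then have "ereal 0 < ereal t"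
      using low[OF order_refl] t(1) by (metis order_le_less_trans)
    then have "0 \<le> t"
      by simp
    moreover have "energy \<mu> t < \<infinity>"
    proof (rule ccontr)
      assume "\<not> ?thesis"
      then have "energy \<mu> t = \<infinity>"
        by (metis infinity_ennreal_def less_top)
      with \<open>0 \<le> t\<close> have "dim_cor \<mu> \<le> ereal t"
        unfolding dim_cor_def by (intro Inf_lower) auto
      with t(2) show False
        by simp
    qed
    ultimately show False
      using low[of t] t(1) by simp
  qed
  show "?L \<le> dim_cor \<mu>"
    unfolding dim_cor_def
  proof (rule Inf_greatest, clarify, rule ccontr)
    fix s assume s: "0 \<le> s" "energy \<mu> s = \<infinity>" "\<not> ?L \<le> ereal s"
    then obtain t where t: "ereal s < ereal t" "ereal t < ?L"
      by (meson ereal_dense2 not_le)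
    \<comment> \<open>Below the lower limit the quotient eventually exceeds \<open>t\<close>;
      multiplying by the negative \<open>ln (\<delta> n)\<close> yields the power bound, with
      \<open>s < t\<close> as the room needed for finite energy.\<close>
    have "\<forall>\<^sub>F n in sequentially. ?S n \<le> \<delta> n powr t"
      using less_LiminfD[OF t(2)] general_filtration_eventually(2)[OF assms(3)]
    proof eventually_elim
      case (elim n)
      have pos: "0 < \<delta> n"
        using assms(3) by (simp add: general_filtration_def)
      show ?case
      proof (cases "?S n = 0")
        case False
        then have S: "0 < ?S n"
          by (simp add: sum_nonneg order_less_le)
        have ln: "ln (\<delta> n) < 0"
          using elim(2) pos by simp
        have "t < ln (?S n) / ln (\<delta> n)"
          using elim(1) False ln by (simp add: ext_ln_def)
        then have "ln (?S n) < t * ln (\<delta> n)"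
          using ln by (simp add: field_simps)
        then have "exp (ln (?S n)) < exp (t * ln (\<delta> n))"
          by (simp only: exp_less_mono)
        then show ?thesis
          using S pos by (simp add: powr_def)
      qed simp
    qed
    then have "energy \<mu> s < \<infinity>"
      using t(1) by (intro energy_finite_general_filtration[OF assms(1,2,3,4) sp assms(6) s(1)]) auto
    with s(2) show False
      by simp
  qed
qed

end
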